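(* Let $\mathcal{B}=\{u\in\Sigma^+ : u_0=0\}$. The map $\Delta_T:\mathcal{B}\to(\Sigma\cup\mathrm{S}_\Sigma)^+$ is injective and satisfies $\Delta_T(0)=?$ and $\Delta_T(u\times v)=\Delta_T(u)\circ\Delta_T(v)$ for all $u,v\in\mathcal{B}$; i.e. it is an injective monoid homomorphism from $(\mathcal{B},\times,0)$ into the monoid of $\Sigma$-patterns under Toeplitz composition with identity $?$.
   Context: $\Sigma$ is a fixed finite cyclic group; $\mathrm{S}_\Sigma$ the group of bijections of $\Sigma$ (gaps), $?$ its identity, $\rho_d$ the bijection $x\mapsto x+d$. Keane product: $u\times\varepsilon=\varepsilon$, $u\times(av)=(u+a)(u\times v)$ where $u+a$ adds $a$ to each letter. First difference: $\Delta(x_0\dots x_{k-1})=(x_1-x_0)\dots(x_{k-1}-x_{k-2})$ ($=\varepsilon$ if $k=1$). $\Delta_T(u)=\Delta(u)\,\rho_{-u_{|u|-1}}$. For finite words $x,y$ over $\Sigma\cup\mathrm{S}_\Sigma$ with number of gaps of $x$ equal to $|y|$: $x\langle\varepsilon\rangle=x$, $(a\,x)\langle y\rangle=a\,x\langle y\rangle$, $(f\,x)\langle b\,y\rangle=f(b)\,x\langle y\rangle$, $(f\,x)\langle g\,y\rangle=(f\circ g)\,x\langle y\rangle$. With $\xi(n,m)=m/\gcd(n,m)$ and $|P|_?$ the number of gaps, the Toeplitz composition is $P\circ Q=P$ if $|P|_?=0$, else $P\circ Q=P^{d_1}\langle Q^{d_2}\rangle$ with $d_1=\xi(|P|_?,|Q|)$,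 $d_2=\xi(|Q|,|P|_?)$. *)

theory Defs
  imports "HOL-Algebra.Elementary_Groups"
begin

text \<open>
  The alphabet \<open>\<Sigma>\<close> is a type \<open>'a :: {ab_group_add, finite}\<close>; cyclicity is stated with the
  library predicate \<open>cyclic_group\<close>, applied to the additive group of the type.
\<close>

definition additive_group :: "'a::ab_group_add monoid" where
  "additive_group = \<lparr>carrier = UNIV, monoid.mult = (+), one = 0\<rparr>"

primrec keane :: "'a::ab_group_add list \<Rightarrow> 'a list \<Rightarrow> 'a list" where
  "keane u [] = []"
| "keane u (a # v) = map (\<lambda>x. x + a) u @ keane u v"

definition block_words :: "'a::ab_group_add list set" where
  "block_words = {u. u \<noteq> [] \<and> u ! 0 = 0}"

definition keane_monoid :: "'a::ab_group_add list monoid" where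
  "keane_monoid = \<lparr>carrier = block_words, monoid.mult = keane, one = [0]\<rparr>"

text \<open>
  A word over \<open>\<Sigma> \<union> S\<^sub>\<Sigma>\<close> is a list over the disjoint sum: \<open>Inl a\<close> is the letter \<open>a\<close>,
  and \<open>Inr f\<close> is the gap \<open>f\<close>. Bijectivity of the gaps is imposed by the set \<open>patterns\<close>.
\<close>

type_synonym 'a pattern = "('a + ('a \<Rightarrow> 'a)) list"

definition patterns :: "'a pattern set" where
  "patterns = {P. P \<noteq> [] \<and> set P \<subseteq> UNIV <+> {f. bij f}}"

definition gap_id :: "'a + ('a \<Rightarrow> 'a)" where
  "gap_id = Inr id"

definition gap_rot :: "'a::ab_group_add \<Rightarrow> 'a + ('a \<Rightarrow> 'a)" where
  "gap_rot d = Inr (\<lambda>x. x + d)"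

definition gaps :: "'a pattern \<Rightarrow> nat" where
  "gaps P = length (filter (\<lambda>c. \<not> isl c) P)"

text \<open>
  \<open>fill x y\<close> is \<open>x\<langle>y\<rangle>\<close>. It is only meaningful if \<open>gaps x = length y\<close>; the last equation
  is a dummy value outside that domain.
\<close>

fun fill :: "'a pattern \<Rightarrow> 'a pattern \<Rightarrow> 'a pattern" where
  "fill x [] = x"
| "fill (Inl a # x) y = Inl a # fill x y"
| "fill (Inr f # x) (Inl b # y) = Inl (f b) # fill x y"
| "fill (Inr f # x) (Inr g # y) = Inr (f \<circ> g) # fill x y"
| "fill [] y = []"

definition xi :: "nat \<Rightarrow> nat \<Rightarrow> nat" where
  "xi n m = m div gcd n m"

definition word_power :: "'b list \<Rightarrow> nat \<Rightarrow> 'b list" where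
  "word_power w d = concat (replicate d w)"

definition toeplitz :: "'a pattern \<Rightarrow> 'a pattern \<Rightarrow> 'a pattern" where
  "toeplitz P Q =
     (if gaps P = 0 then P
      else fill (word_power P (xi (gaps P) (length Q))) (word_power Q (xi (length Q) (gaps P))))"

definition pattern_monoid :: "'a pattern monoid" where
  "pattern_monoid = \<lparr>carrier = patterns, monoid.mult = toeplitz, one = [gap_id]\<rparr>"

definition Delta :: "'a::ab_group_add list \<Rightarrow> 'a list" where
  "Delta u = map (\<lambda>i. u ! (i + 1) - u ! i) [0..<length u - 1]"

definition Delta_T :: "'a::ab_group_add list \<Rightarrow> 'a pattern" where
  "Delta_T u = map Inl (Delta u) @ [gap_rot (- (u ! (length u - 1)))]"

end

(* The pattern fill is associative and compatible with concatenation, so both bracketings of a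
   triple Toeplitz composition have the form P^i \<langle>Q^j \<langle>R^k\<rangle>\<rangle>. If P has a gaps and Q has b,
   then i = |Q| |R| / gcd (a b, a |R|, |Q| |R|) in both, and i determines j and k by counting
   gaps. The pattern Delta_T u has a single gap, its last symbol, which stores minus the last
   letter of u: filling it with a difference of v gives the jump between consecutive shifted copies
   of u, because u starts with 0. *)

theory Submission
  imports Defs
begin

section \<open>Filling\<close>

lemma gaps_simps [simp]:
  "gaps [] = 0"
  "gaps (Inl a # x) = gaps x"
  "gaps (Inr f # x) = Suc (gaps x)"
  "gaps (x @ y) = gaps x + gaps y"
  by (auto simp: gaps_def)

text \<open>The equations of \<open>fill\<close> test for an empty filler first. A letter is copied
  in either case, so inductions on the pattern need no such split there.\<close>

lemma fill_Inl [simp]: "fill (Inl a # x) y = Inl a # fill x y"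
  by (cases y) auto

lemma fill_Inr_Cons [simp]: "fill (Inr f # x) (c # y) = map_sum f ((\<circ>) f) c # fill x y"
  by (cases c) auto

lemma pattern_induct [case_names Nil Inl Inr]:
  assumes "Q []" "\<And>a x. Q x \<Longrightarrow> Q (Inl a # x)" "\<And>f x. Q x \<Longrightarrow> Q (Inr f # x)"
  shows "Q (x :: 'a pattern)"
proof (induction x)
  case (Cons c x)
  then show ?case using assms by (cases c) auto
qed (rule assms)

lemma length_fill [simp]: "gaps x = length y \<Longrightarrow> length (fill x y) = length x"
proof (induction x arbitrary: y rule: pattern_induct)
  case (Inr f x)
  then show ?case by (cases y) auto
qed auto

text \<open>A letter of \<open>y\<close> closes a gap of \<open>x\<close>, a gap of \<open>y\<close>
  keeps it open.\<close>

lemma gaps_fill [simp]: "gaps x = length y \<Longrightarrow> gaps (fill x y) = gaps y"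
proof (induction x arbitrary: y rule: pattern_induct)
  case (Inr f x)
  then obtain c y' where "y = c # y'" by (cases y) auto
  then show ?case using Inr by (cases c) auto
qed auto

lemma fill_append:
  "gaps x = length y \<Longrightarrow> fill (x @ x') (y @ y') = fill x y @ fill x' y'"
proof (induction x arbitrary: y rule: pattern_induct)
  case (Inr f x)
  then show ?case by (cases y) auto
qed auto

lemma fill_assoc:
  "gaps x = length y \<Longrightarrow> gaps y = length z \<Longrightarrow> fill (fill x y) z = fill x (fill y z)"
proof (induction x arbitrary: y z rule: pattern_induct)
  case (Inr f x)
  then obtain c y' where y: "y = c # y'" by (cases y) auto
  show ?case
  proof (cases c)
    case (Inl a)
    \<comment> \<open>The letter \<open>c\<close> closes the gap, so neither side consumes a symbol
      of \<open>z\<close> here.\<close>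
    then show ?thesis using Inr y by auto
  next
    case (Inr g)
    then obtain d z' where z: "z = d # z'" using Inr.prems y by (cases z) auto
    then have "fill (fill x y') z' = fill x (fill y' z')"
      using Inr.IH Inr.prems Inr y by auto
    then show ?thesis using Inr y z by (cases d) auto
  qed
qed auto

lemma fill_patterns:
  assumes "gaps x = length y" "set x \<subseteq> UNIV <+> {f. bij f}" "set y \<subseteq> UNIV <+> {f. bij f}"
  shows "set (fill x y) \<subseteq> UNIV <+> {f. bij f}"
  using assms
proof (induction x arbitrary: y rule: pattern_induct)
  case (Inr f x)
  then obtain c y' where "y = c # y'" by (cases y) auto
  then show ?case using Inr by (cases c) (auto intro: bij_comp)
qed auto

section \<open>Toeplitz composition\<close>

lemma word_power_simps [simp]:
  "word_power w 0 = []"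
  "word_power w (Suc n) = w @ word_power w n"
  by (auto simp: word_power_def)

lemma word_power_add: "word_power w (m + n) = word_power w m @ word_power w n"
  by (simp add: word_power_def replicate_add)

lemma word_power_mult: "word_power w (m * n) = word_power (word_power w m) n"
  by (induction n) (auto simp: word_power_add)

lemma length_word_power [simp]: "length (word_power w n) = length w * n"
  by (induction n) auto

lemma gaps_word_power [simp]: "gaps (word_power w n) = gaps w * n"
  by (induction n) auto

lemma set_word_power_subset: "set (word_power w n) \<subseteq> set w"
  by (auto simp: word_power_def)

lemma word_power_fill:
  "gaps x = length y \<Longrightarrow> word_power (fill x y) n = fill (word_power x n) (word_power y n)"
  by (induction n) (auto simp: fill_append)

text \<open>Both products are lcm(n, m). This makes the number of gaps in the power of P match the
  length of the power of Q.\<close>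

lemma xi_balance: "n * xi n m = m * xi m n"
  by (simp add: xi_def div_mult_swap gcd.commute[of n m] mult.commute[of n m])

lemma xi_pos: "0 < m \<Longrightarrow> 0 < xi n m"
  by (simp add: xi_def div_greater_zero_iff dvd_imp_le)

lemma gcd_mult_xi: "gcd n m * xi n m = m"
  by (simp add: xi_def)

text \<open>If P has no gaps, the exponents are \<open>xi 0 m = 1\<close> and
  \<open>xi m 0 = 0\<close> for m > 0, so filling returns P and the case distinction disappears. For
  m = 0 the first exponent would be 0.\<close>

lemma toeplitz_eq_fill:
  assumes "Q \<noteq> []"
  shows "toeplitz P Q =
    fill (word_power P (xi (gaps P) (length Q))) (word_power Q (xi (length Q) (gaps P)))"
  using assms by (simp add: toeplitz_def xi_def)

lemma length_toeplitz: "Q \<noteq> [] \<Longrightarrow> length (toeplitz P Q) = length P * xi (gaps P) (length Q)"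
  by (simp add: toeplitz_eq_fill xi_balance)

lemma gaps_toeplitz: "Q \<noteq> [] \<Longrightarrow> gaps (toeplitz P Q) = gaps Q * xi (length Q) (gaps P)"
  by (simp add: toeplitz_eq_fill xi_balance)

lemma toeplitz_nonempty: "P \<noteq> [] \<Longrightarrow> Q \<noteq> [] \<Longrightarrow> toeplitz P Q \<noteq> []"
  using length_toeplitz[of Q P] xi_pos[of "length Q" "gaps P"] by auto

text \<open>With a, b the gap counts of P, Q and q, r the lengths of Q, R, these are the exponents
  of P in the two bracketings: \<open>b * xi q a\<close> counts the gaps of P \<circ> Q, and
  \<open>q * xi b r\<close> is the length of Q \<circ> R.\<close>

lemma xi_cocycle:
  assumes "0 < q" "0 < r"
  shows "xi a q * xi (b * xi q a) r = xi a (q * xi b r)"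
proof -
  \<comment> \<open>Multiplying by the other gcd clears the denominator hidden in \<open>xi\<close>;
    both products of gcds become gcd(ab, ar, qr).\<close>
  have "gcd a q * (b * xi q a) = a * b"
    by (metis gcd.commute gcd_mult_xi mult.assoc mult.commute)
  then have "gcd a q * gcd (b * xi q a) r = gcd (a * b) (gcd (a * r) (q * r))"
    by (simp only: gcd_mult_distrib_nat mult.commute[of _ r])
  moreover have "gcd b r * (q * xi b r) = q * r"
    by (metis gcd_mult_xi mult.left_commute)
  then have "gcd b r * gcd a (q * xi b r) = gcd (gcd (a * b) (a * r)) (q * r)"
    by (simp only: gcd_mult_distrib_nat mult.commute[of _ a])
  ultimately have G: "gcd a q * gcd (b * xi q a) r = gcd b r * gcd a (q * xi b r)"
    by (simp only: gcd.assoc)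
  have "(gcd a q * gcd (b * xi q a) r) * (xi a q * xi (b * xi q a) r)
      = (gcd a q * xi a q) * (gcd (b * xi q a) r * xi (b * xi q a) r)"
    by (simp only: ac_simps)
  also have "\<dots> = q * (gcd b r * xi b r)"
    by (simp only: gcd_mult_xi)
  also have "\<dots> = gcd b r * (gcd a (q * xi b r) * xi a (q * xi b r))"
    by (metis gcd_mult_xi mult.left_commute)
  \<comment> \<open>The common factor cancels: r and \<open>q * xi b r\<close> are positive, hence
    so are the gcds.\<close>
  finally show ?thesis
    using assms xi_pos[of r b] unfolding G by (auto simp: mult.assoc)
qed

lemma toeplitz_assoc:
  assumes "Q \<noteq> []" "R \<noteq> []"
  shows "toeplitz (toeplitz P Q) R = toeplitz P (toeplitz Q R)"
proof -
  define a q b r where "a = gaps P" and "q = length Q" and "b = gaps Q" and "r = length R"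
  note defs = a_def q_def b_def r_def
  have pos: "0 < q" "0 < r" using assms by (auto simp: defs)
  \<comment> \<open>The exponents of P, Q and R read off from the left bracketing.\<close>
  define i j k where "i = xi a q * xi (b * xi q a) r" and "j = xi q a * xi (b * xi q a) r"
    and "k = xi r (b * xi q a)"
  have aij: "a * i = q * j"
    unfolding i_def j_def using xi_balance[of a q] by (metis mult.assoc)
  have bjk: "b * j = r * k"
    unfolding j_def k_def using xi_balance[of "b * xi q a" r] by (simp add: mult.assoc)
  have i: "i = xi a (q * xi b r)"
    unfolding i_def using pos by (rule xi_cocycle)
  \<comment> \<open>The exponents of the right bracketing satisfy the same balance equations;
    cancelling q, and then r, identifies j and k.\<close>
  have "q * j = q * (xi b r * xi (q * xi b r) a)"
    unfolding aij[symmetric] i xi_balance[of a "q * xi b r"] by (simp only: mult.assoc)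
  then have j: "j = xi b r * xi (q * xi b r) a" using pos by simp
  have "r * k = r * (xi r b * xi (q * xi b r) a)"
    using bjk xi_balance[of b r] unfolding j by (metis mult.assoc)
  then have k: "k = xi r b * xi (q * xi b r) a" using pos by simp
  have "toeplitz (toeplitz P Q) R =
      fill (word_power (toeplitz P Q) (xi (b * xi q a) r)) (word_power R k)"
    using assms by (simp add: toeplitz_eq_fill[of R] gaps_toeplitz defs k_def)
  also have "\<dots> = fill (fill (word_power P i) (word_power Q j)) (word_power R k)"
    using assms
    by (simp add: toeplitz_eq_fill word_power_fill word_power_mult xi_balance defs i_def j_def)
  also have "\<dots> = fill (word_power P i) (fill (word_power Q j) (word_power R k))"
    using aij bjk by (intro fill_assoc) (simp_all add: defs)
  also have "fill (word_power Q j) (word_power R k) =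
      word_power (toeplitz Q R) (xi (q * xi b r) a)"
    using assms by (simp add: toeplitz_eq_fill word_power_fill word_power_mult xi_balance defs j k)
  also have "fill (word_power P i) \<dots> = toeplitz P (toeplitz Q R)"
    using assms
    by (simp add: toeplitz_eq_fill[of "toeplitz Q R"] toeplitz_nonempty length_toeplitz defs i)
  finally show ?thesis .
qed

section \<open>The identity pattern and the monoid of patterns\<close>

lemma fill_replicate_gap_id [simp]: "fill x (replicate (gaps x) gap_id) = x"
  by (induction x rule: pattern_induct) (auto simp: gap_id_def)

lemma fill_gap_id_replicate [simp]: "fill (replicate (length y) gap_id) y = y"
proof (induction y)
  case (Cons c y)
  then show ?case by (cases c) (auto simp: gap_id_def)
qed auto

lemma word_power_singleton [simp]: "word_power [c] n = replicate n c"
  by (induction n) auto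

lemma xi_1 [simp]: "xi n (Suc 0) = Suc 0" "xi (Suc 0) n = n"
  by (simp_all add: xi_def)

lemma gaps_gap_id [simp]: "gaps [gap_id] = Suc 0"
  by (simp add: gap_id_def)

lemma toeplitz_gap_id_right: "toeplitz P [gap_id] = P"
  by (simp add: toeplitz_eq_fill)

lemma toeplitz_gap_id_left: "Q \<noteq> [] \<Longrightarrow> toeplitz [gap_id] Q = Q"
  by (simp add: toeplitz_eq_fill)

lemma patterns_nonempty: "P \<in> patterns \<Longrightarrow> P \<noteq> []"
  by (simp add: patterns_def)

lemma toeplitz_patterns:
  assumes "P \<in> patterns" "Q \<in> patterns"
  shows "toeplitz P Q \<in> patterns"
proof -
  have ne: "P \<noteq> []" "Q \<noteq> []"
    and sub: "set P \<subseteq> UNIV <+> {f. bij f}" "set Q \<subseteq> UNIV <+> {f. bij f}"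
    using assms by (auto simp: patterns_def)
  have "set (toeplitz P Q) \<subseteq> UNIV <+> {f. bij f}"
    unfolding toeplitz_eq_fill[OF ne(2)]
    by (intro fill_patterns order_trans[OF set_word_power_subset] sub) (simp add: xi_balance)
  then show ?thesis using toeplitz_nonempty ne by (simp add: patterns_def)
qed

lemma monoid_pattern_monoid: "Group.monoid pattern_monoid"
proof (rule monoidI)
  show "\<one>\<^bsub>pattern_monoid\<^esub> \<in> carrier pattern_monoid"
    by (auto simp: pattern_monoid_def patterns_def gap_id_def)
qed (simp_all add: pattern_monoid_def toeplitz_patterns toeplitz_gap_id_right
    toeplitz_assoc toeplitz_gap_id_left patterns_nonempty)

section \<open>Keane product\<close>

lemma keane_append: "keane u (v @ w) = keane u v @ keane u w"
  by (induction v) auto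

text \<open>This handles one shifted copy of the middle factor in the proof of
  associativity.\<close>

lemma keane_map_add: "keane u (map (\<lambda>x. x + a) v) = map (\<lambda>x. x + a) (keane u v)"
  by (induction v) (auto simp: add.assoc)

lemma keane_assoc: "keane (keane u v) w = keane u (keane v w)"
  by (induction w) (auto simp: keane_append keane_map_add)

lemma keane_eq_Nil_iff [simp]: "keane u v = [] \<longleftrightarrow> u = [] \<or> v = []"
  by (induction v) auto

lemma hd_keane: "u \<noteq> [] \<Longrightarrow> v \<noteq> [] \<Longrightarrow> hd (keane u v) = hd u + hd v"
  by (cases v) (auto simp: hd_map)

lemma last_keane: "u \<noteq> [] \<Longrightarrow> v \<noteq> [] \<Longrightarrow> last (keane u v) = last u + last v"
  by (induction v) (auto simp: last_map)

lemma keane_zero_right [simp]: "keane u [0] = u"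
  by simp

lemma keane_zero_left [simp]: "keane [0] v = v"
  by (induction v) auto

lemma mem_block_words_iff: "u \<in> block_words \<longleftrightarrow> u \<noteq> [] \<and> hd u = 0"
  by (auto simp: block_words_def hd_conv_nth)

lemma monoid_keane_monoid: "Group.monoid keane_monoid"
  by (rule monoidI)
    (auto simp: keane_monoid_def mem_block_words_iff hd_keane keane_assoc simp del: keane.simps)

section \<open>Differences\<close>

lemma Delta_simps [simp]:
  "Delta [] = []"
  "Delta [x] = []"
  "Delta (x # y # u) = (y - x) # Delta (y # u)"
  by (simp_all add: Delta_def map_upt_Suc del: upt_Suc)

lemma Delta_T_eq: "u \<noteq> [] \<Longrightarrow> Delta_T u = map Inl (Delta u) @ [gap_rot (- last u)]"
  by (simp add: Delta_T_def last_conv_nth)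

lemma Delta_map_add: "Delta (map (\<lambda>x. x + a) u) = Delta u"
  by (simp add: Delta_def)

lemma Delta_append:
  "u \<noteq> [] \<Longrightarrow> v \<noteq> [] \<Longrightarrow> Delta (u @ v) = Delta u @ (hd v - last u) # Delta v"
proof (induction u rule: induct_list012)
  case (2 x)
  then show ?case by (cases v) auto
qed auto

section \<open>Block words as patterns with one gap\<close>

lemma gaps_map_Inl [simp]: "gaps (map Inl w) = 0"
  by (induction w) auto

lemma fill_map_Inl_append [simp]: "fill (map Inl w @ x) y = map Inl w @ fill x y"
  by (induction w) auto

lemma gaps_Delta_T: "gaps (Delta_T u) = Suc 0"
  by (simp add: Delta_T_def gap_rot_def)

lemma length_Delta_T: "u \<noteq> [] \<Longrightarrow> length (Delta_T u) = length u"
  by (simp add: Delta_T_def Delta_def)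

lemma Delta_T_patterns: "Delta_T u \<in> patterns"
  using bij_plus_right[of "- (u ! (length u - 1))"]
  by (auto simp: patterns_def Delta_T_def gap_rot_def)

text \<open>Summing the differences from the first letter recovers the word. The length tells the
  empty word from a one-letter word, which both have no differences.\<close>

lemma Delta_inject:
  assumes "Delta u = Delta v" "length u = length v" "hd u = hd v"
  shows "u = v"
  using assms(2,1,3)
proof (induction u v rule: list_induct2)
  case (Cons x xs y ys)
  then show ?case by (cases xs; cases ys) auto
qed auto

lemma inj_on_Delta_T: "inj_on Delta_T block_words"
proof (rule inj_onI)
  fix u v :: "'a list"
  assume uv: "u \<in> block_words" "v \<in> block_words" "Delta_T u = Delta_T v"
  then have "length u = length v"
    by (metis length_Delta_T mem_block_words_iff)
  moreover have "Delta u = Delta v"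
    using uv(3) by (simp add: Delta_T_def inj_map_eq_map)
  ultimately show "u = v"
    using uv(1,2) by (simp add: Delta_inject mem_block_words_iff)
qed

text \<open>\<open>Delta_T u\<close> has one gap, so a copy of it is used for each symbol of
  \<open>Delta_T v\<close>. The first letter of \<open>v\<close> is left free because the induction
  passes to tails of \<open>v\<close>.\<close>

lemma fill_word_power_Delta_T:
  assumes "u \<noteq> []" "hd u = 0" "v \<noteq> []"
  shows "fill (word_power (Delta_T u) (length v)) (Delta_T v) = Delta_T (keane u v)"
  using assms(3)
proof (induction v rule: induct_list012)
  \<comment> \<open>Here two gaps compose: subtracting a and then \<open>last u\<close> subtracts
    the last letter of the shifted copy of \<open>u\<close>.\<close>
  case (2 a)
  then show ?case
    using assms(1)
    by (simp add: Delta_T_eq Delta_map_add last_map gap_rot_def fun_eq_iff algebra_simps)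
next
  case (3 a b v)
  have K: "keane u (a # b # v) = map (\<lambda>x. x + a) u @ keane u (b # v)" by simp
  \<comment> \<open>The next copy starts with b since \<open>hd u = 0\<close>. The jump b - (last u
    + a) is the image of b - a under the gap of \<open>Delta_T u\<close>.\<close>
  have "Delta_T (keane u (a # b # v)) =
      map Inl (Delta u) @ Inl (b - (last u + a)) # Delta_T (keane u (b # v))"
    unfolding K using assms hd_keane[of u "b # v"] last_keane[of u "b # v"]
    by (simp add: Delta_T_eq Delta_append Delta_map_add last_map hd_map)
  moreover have "Delta_T (a # b # v) = Inl (b - a) # Delta_T (b # v)"
    by (simp add: Delta_T_eq)
  ultimately show ?case
    using 3 assms(1) by (simp add: Delta_T_eq[of u] gap_rot_def algebra_simps)
qed auto

lemma Delta_T_keane: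
  assumes "u \<in> block_words" "v \<in> block_words"
  shows "Delta_T (keane u v) = toeplitz (Delta_T u) (Delta_T v)"
proof -
  have "Delta_T v \<noteq> []" by (simp add: Delta_T_def)
  then show ?thesis
    using assms fill_word_power_Delta_T[of u v]
    by (simp add: toeplitz_eq_fill gaps_Delta_T length_Delta_T mem_block_words_iff)
qed

lemma Delta_T_zero: "Delta_T [0] = [gap_id]"
  by (simp add: Delta_T_def gap_rot_def gap_id_def id_def)

theorem mainTheorem4:
  assumes "cyclic_group (additive_group :: 'a::{ab_group_add, finite} monoid)"
  shows "Delta_T ` (block_words :: 'a list set) \<subseteq> patterns
    \<and> inj_on Delta_T (block_words :: 'a list set)
    \<and> Delta_T [0 :: 'a] = [gap_id]
    \<and> (\<forall>u \<in> block_words. \<forall>v \<in> block_words.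
          Delta_T (keane u v :: 'a list) = toeplitz (Delta_T u) (Delta_T v))
    \<and> Group.monoid (keane_monoid :: 'a list monoid)
    \<and> Group.monoid (pattern_monoid :: 'a pattern monoid)
    \<and> (Delta_T :: 'a list \<Rightarrow> 'a pattern) \<in> mon keane_monoid pattern_monoid
    \<and> Delta_T \<one>\<^bsub>keane_monoid :: 'a list monoid\<^esub> = \<one>\<^bsub>pattern_monoid\<^esub>"
proof -
  \<comment> \<open>\<open>mon\<close> collects closure, multiplicativity and injectivity;
    preservation of the unit comes from \<open>Delta_T_zero\<close>.\<close>
  have "Delta_T \<in> mon (keane_monoid :: 'a list monoid) pattern_monoid"
    by (auto simp: mon_def hom_def keane_monoid_def pattern_monoid_def
        Delta_T_patterns Delta_T_keane inj_on_Delta_T)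
  then show ?thesis
    using Delta_T_patterns inj_on_Delta_T Delta_T_zero Delta_T_keane
      monoid_keane_monoid monoid_pattern_monoid
    by (auto simp: keane_monoid_def pattern_monoid_def)
qed

end
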